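(* Let $\Lambda$ be an integral lattice of minimum $\mu$, let $K\subseteq\Lambda$ be a sublattice of rank $k$ with real span $U$, and put $V=U^{\perp}$. Let $$\rho_{\mathrm{glue}}(K)=\max_{y\in K^{*}}\operatorname{dist}(y,K),$$ which is a maximum over the finitely many classes of $K^{*}/K$. Then every $v\in\Lambda$ with $\pi_V(v)\neq 0$ satisfies $$|\pi_V(v)|^2\ \ge\ \mu-\rho_{\mathrm{glue}}(K)^2 .$$ Moreover $\rho_{\mathrm{glue}}(K)\le\rho_{\mathrm{cov}}(K)$, where $\rho_{\mathrm{cov}}(K)$ is the covering radius of $K$.
   Context: A lattice is integral if all inner products of its vectors are integers. The minimum of a lattice is the smallest squared norm of its nonzero vectors. $K^{*}=\{y\in U:\langle y,x\rangle\in\mathbb{Z}\text{ for all }x\in K\}$ is the dual of $K$ in $U$. $\pi_V$ is the orthogonal projection onto $V$, the orthogonal complement of $U$ in the ambient Euclidean space of $\Lambda$. $\operatorname{dist}(y,K)=\min_{x\in K}|y-x|$. The covering radius is $\rho_{\mathrm{cov}}(K)=\max_{y\in U}\operatorname{dist}(y,K)$. *)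

theory Defs
  imports "HOL-Analysis.Analysis"
begin

definition int_span :: "'a::euclidean_space set \<Rightarrow> 'a set" where
  "int_span B = range (\<lambda>c :: 'a \<Rightarrow> int. \<Sum>b\<in>B. of_int (c b) *\<^sub>R b)"

(* A lattice need not have full rank in the ambient space. A basis B is automatically
   finite, since an independent set in a Euclidean space is. *)
definition lattice_of_rank :: "nat \<Rightarrow> 'a::euclidean_space set \<Rightarrow> bool" where
  "lattice_of_rank k L \<longleftrightarrow> (\<exists>B. independent B \<and> card B = k \<and> L = int_span B)"

definition is_lattice :: "'a::euclidean_space set \<Rightarrow> bool" where
  "is_lattice L \<longleftrightarrow> (\<exists>k. lattice_of_rank k L)"

definition integral_lattice :: "'a::euclidean_space set \<Rightarrow> bool" where
  "integral_lattice L \<longleftrightarrow> is_lattice L \<and> (\<forall>x\<in>L. \<forall>y\<in>L. x \<bullet> y \<in> \<int>)"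

(* LEAST and GREATEST denote a minimum and a maximum that is attained; they are
   unspecified otherwise (for the minimum: when L is the zero lattice). *)
definition lattice_minimum :: "'a::euclidean_space set \<Rightarrow> real" where
  "lattice_minimum L = (LEAST m. m \<in> (\<lambda>x. (norm x)\<^sup>2) ` (L - {0}))"

(* The dual is taken inside the real span of K, not in the whole ambient space. *)
definition dual_lattice :: "'a::euclidean_space set \<Rightarrow> 'a set" where
  "dual_lattice K = {y \<in> span K. \<forall>x\<in>K. y \<bullet> x \<in> \<int>}"

(* Congruence modulo K on the dual; K*/K is dual_lattice K // glue_rel K. *)
definition glue_rel :: "'a::euclidean_space set \<Rightarrow> ('a \<times> 'a) set" where
  "glue_rel K = {(y, z). y \<in> dual_lattice K \<and> z \<in> dual_lattice K \<and> y - z \<in> K}"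

(* The distance from y to K is infdist y K; the infimum is a minimum because a lattice
   is closed and nonempty. *)
definition glue_radius :: "'a::euclidean_space set \<Rightarrow> real" where
  "glue_radius K = (GREATEST r. r \<in> (\<lambda>y. infdist y K) ` dual_lattice K)"

definition covering_radius :: "'a::euclidean_space set \<Rightarrow> real" where
  "covering_radius K = (GREATEST r. r \<in> (\<lambda>y. infdist y K) ` span K)"

definition orth_proj :: "'a::euclidean_space set \<Rightarrow> 'a \<Rightarrow> 'a" where
  "orth_proj V x = (THE p. p \<in> V \<and> x - p \<in> V\<^sup>\<bottom>)"

end

theory Submission
  imports Defs
begin

text \<open>
  Split v = p + u with p = \<open>\<pi>\<^sub>V(v)\<close> and u in U. As p is orthogonal to K,
  pairing with u and with v agree on K, so integrality gives u \<in> \<open>K\<^sup>*\<close>. If x \<in> K is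
  closest to u, then v - x is a nonzero vector of the lattice and Pythagoras gives
  \<open>\<mu> \<le> |v - x|\<^sup>2 = |p|\<^sup>2 + dist(u, K)\<^sup>2\<close>. That the maxima are attained follows from reducing
  modulo K to a bounded region: the dual meets it in a finite set, because a vector of U
  is determined by its inner products with a basis of K, and U meets it in a compact set.
\<close>

section \<open>Integer spans\<close>

lemma int_spanI: "(\<Sum>b\<in>B. of_int (c b) *\<^sub>R b) \<in> int_span B"
  by (auto simp: int_span_def)

lemma int_spanE:
  assumes "x \<in> int_span B"
  obtains c where "x = (\<Sum>b\<in>B. of_int (c b) *\<^sub>R b)"
  using assms by (auto simp: int_span_def)

lemma zero_in_int_span: "0 \<in> int_span B"
  using int_spanI[of "\<lambda>_. 0" B] by simp

lemma int_span_diff: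
  assumes "x \<in> int_span B" "y \<in> int_span B"
  shows "x - y \<in> int_span B"
proof -
  obtain c d where "x = (\<Sum>b\<in>B. of_int (c b) *\<^sub>R b)" "y = (\<Sum>b\<in>B. of_int (d b) *\<^sub>R b)"
    using assms by (auto elim!: int_spanE)
  then have "x - y = (\<Sum>b\<in>B. of_int (c b - d b) *\<^sub>R b)"
    by (simp add: sum_subtractf scaleR_diff_left)
  then show ?thesis
    using int_spanI[of "\<lambda>b. c b - d b" B] by simp
qed

lemma int_span_subset_span: "int_span B \<subseteq> span B"
  by (auto elim!: int_spanE intro: span_sum span_scale span_base)

lemma subset_int_span:
  assumes "finite B"
  shows "B \<subseteq> int_span B"
proof
  fix b assume "b \<in> B"
  have "(\<Sum>a\<in>B. of_int (if a = b then 1 else 0) *\<^sub>R a) = (\<Sum>a\<in>B. if a = b then a else 0)"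
    by (intro sum.cong) auto
  also have "\<dots> = b"
    using assms \<open>b \<in> B\<close> by simp
  finally show "b \<in> int_span B"
    using int_spanI[of "\<lambda>a. if a = b then 1 else 0" B] by simp
qed

lemma span_int_span:
  assumes "finite B"
  shows "span (int_span B) = span B"
proof
  show "span (int_span B) \<subseteq> span B"
    by (simp add: int_span_subset_span span_minimal)
  show "span B \<subseteq> span (int_span B)"
    by (simp add: assms span_mono subset_int_span)
qed

section \<open>Lattices as groups and reduction modulo a lattice\<close>

lemma is_lattice_diff:
  assumes "is_lattice L" "x \<in> L" "y \<in> L"
  shows "x - y \<in> L"
  using assms by (auto simp: is_lattice_def lattice_of_rank_def intro: int_span_diff)

lemma zero_in_lattice:
  assumes "is_lattice L"
  shows "0 \<in> L"
  using assms by (auto simp: is_lattice_def lattice_of_rank_def intro: zero_in_int_span)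

text \<open>Rounding down the real coordinates with respect to a basis leaves a remainder in the
  fundamental parallelepiped, whose points have norm at most the sum of the norms of the basis
  vectors. That sum serves as \<open>R\<close> for every \<open>y\<close>.\<close>

lemma lattice_reduction:
  fixes L :: "'a::euclidean_space set"
  assumes "is_lattice L"
  obtains R where "\<And>y. y \<in> span L \<Longrightarrow> \<exists>x\<in>L. norm (y - x) \<le> R"
proof -
  obtain B where B: "independent B" "L = int_span B"
    using assms by (auto simp: is_lattice_def lattice_of_rank_def)
  have fin: "finite B"
    using B(1) by (rule independent_imp_finite)
  have "\<exists>x\<in>L. norm (y - x) \<le> (\<Sum>b\<in>B. norm b)" if y: "y \<in> span L" for y
  proof -
    obtain c where c: "y = (\<Sum>b\<in>B. c b *\<^sub>R b)"
      using y by (auto simp: B(2) span_int_span[OF fin] span_finite[OF fin])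
    let ?x = "\<Sum>b\<in>B. of_int \<lfloor>c b\<rfloor> *\<^sub>R b"
    have "y - ?x = (\<Sum>b\<in>B. frac (c b) *\<^sub>R b)"
      by (simp add: c frac_def sum_subtractf scaleR_diff_left)
    also have "norm \<dots> \<le> (\<Sum>b\<in>B. norm b)"
      by (intro sum_norm_le) (auto intro!: mult_left_le_one_le less_imp_le[OF frac_lt_1])
    finally show ?thesis
      using int_spanI[of "\<lambda>b. \<lfloor>c b\<rfloor>" B] unfolding B(2) by blast
  qed
  then show thesis
    by (rule that)
qed

text \<open>Translation by a lattice vector permutes the lattice. Distances are therefore functions
  of cosets, and both radii can be computed on a bounded region.\<close>

lemma infdist_diff_lattice:
  assumes "is_lattice L" "x \<in> L"
  shows "infdist (y - x) L = infdist y L"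
proof -
  have le: "infdist z L \<le> infdist (z - w) L" if w: "w \<in> L" for z w
  proof -
    have neg: "- w \<in> L"
      using is_lattice_diff[OF assms(1) zero_in_lattice[OF assms(1)] w] by simp
    have "infdist z L \<le> dist (z - w) a" if a: "a \<in> L" for a
    proof -
      have "a + w \<in> L"
        using is_lattice_diff[OF assms(1) a neg] by simp
      then have "infdist z L \<le> dist z (a + w)"
        by (rule infdist_le)
      also have "\<dots> = dist (z - w) a"
        by (simp add: dist_norm algebra_simps)
      finally show ?thesis .
    qed
    then show ?thesis
      using assms(2) by (subst (2) infdist_notempty) (auto intro!: cINF_greatest)
  qed
  have neg: "- x \<in> L"
    using is_lattice_diff[OF assms(1) zero_in_lattice[OF assms(1)] assms(2)] by simp
  \<comment> \<open>Shifting \<open>y\<close> by \<open>x\<close> and then \<open>y - x\<close> by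
    \<open>- x\<close> returns to \<open>y\<close>, so the two instances of \<open>le\<close> are
    opposite inequalities.\<close>
  show ?thesis
    using le[OF assms(2), of y] le[OF neg, of "y - x"] by simp
qed

section \<open>The dual lattice\<close>

lemma dual_lattice_diff:
  assumes "x \<in> dual_lattice L" "y \<in> dual_lattice L"
  shows "x - y \<in> dual_lattice L"
  using assms by (auto simp: dual_lattice_def span_diff inner_diff_left)

text \<open>A dual vector is encoded by its inner products with a basis. These are integers, and by
  Cauchy-Schwarz they are bounded on the ball, so only finitely many codes occur.\<close>

lemma finite_dual_lattice_cball:
  fixes L :: "'a::euclidean_space set"
  assumes "is_lattice L"
  shows "finite (dual_lattice L \<inter> cball 0 r)"
proof -
  obtain B where B: "independent B" "L = int_span B"
    using assms by (auto simp: is_lattice_def lattice_of_rank_def)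
  have fin: "finite B"
    using B(1) by (rule independent_imp_finite)
  let ?D = "dual_lattice L \<inter> cball 0 r"
  \<comment> \<open>\<open>restrict\<close> makes the code an extensional function, so that it lies
    in a finite \<open>PiE\<close>.\<close>
  let ?f = "\<lambda>y. restrict (\<lambda>b. y \<bullet> b) B"
  let ?I = "\<lambda>b. {z \<in> \<int>. - (r * norm b) \<le> z \<and> z \<le> r * norm b}"
  have "inj_on ?f ?D"
  proof (rule inj_onI)
    fix x y assume x: "x \<in> ?D" and y: "y \<in> ?D" and eq: "?f x = ?f y"
    have "orthogonal (x - y) b" if "b \<in> B" for b
      using fun_cong[OF eq, of b] that by (simp add: orthogonal_def inner_diff_left)
    moreover have "x - y \<in> span B"
      using x y by (auto simp: dual_lattice_def B(2) span_int_span[OF fin] span_diff)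
    \<comment> \<open>Orthogonality to the basis extends to its span, which contains
      \<open>x - y\<close> itself.\<close>
    ultimately have "orthogonal (x - y) (x - y)"
      using orthogonal_to_span by blast
    then show "x = y"
      by (simp add: orthogonal_self)
  qed
  moreover have "?f ` ?D \<subseteq> PiE B ?I"
  proof (intro image_subsetI PiE_I)
    fix y b assume y: "y \<in> ?D" and b: "b \<in> B"
    have "\<bar>y \<bullet> b\<bar> \<le> norm y * norm b"
      by (rule Cauchy_Schwarz_ineq2)
    also have "\<dots> \<le> r * norm b"
      using y by (intro mult_right_mono) auto
    finally show "?f y b \<in> ?I b"
      using y b subset_int_span[OF fin] by (auto simp: dual_lattice_def B(2))
  qed auto
  moreover have "finite (PiE B ?I)"
    by (intro finite_PiE fin finite_int_segment)
  ultimately show ?thesis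
    by (meson finite_imageD finite_subset)
qed

section \<open>Discreteness and minimum of integral lattices\<close>

lemma integral_lattice_subset_dual:
  assumes "integral_lattice L"
  shows "L \<subseteq> dual_lattice L"
  using assms by (auto simp: integral_lattice_def dual_lattice_def span_base)

lemma integral_lattice_norm_sq_int:
  assumes "integral_lattice L" "x \<in> L"
  shows "(norm x)\<^sup>2 \<in> \<int>"
  using assms by (auto simp: integral_lattice_def power2_norm_eq_inner)

text \<open>Squared distances between lattice points are integers, so distinct points are at
  distance at least 1. Closedness is what makes a nearest lattice point exist.\<close>

lemma closed_integral_lattice:
  assumes "integral_lattice L"
  shows "closed L"
proof (rule discrete_imp_closed)
  show "\<forall>x\<in>L. \<forall>y\<in>L. dist y x < 1 \<longrightarrow> y = x"
  proof (intro ballI impI)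
    fix x y assume "x \<in> L" "y \<in> L" and lt: "dist y x < 1"
    then have "y - x \<in> L"
      using assms by (auto simp: integral_lattice_def intro: is_lattice_diff)
    then have int: "(norm (y - x))\<^sup>2 \<in> \<int>"
      by (rule integral_lattice_norm_sq_int[OF assms])
    have "(norm (y - x))\<^sup>2 < 1"
      using lt by (simp add: dist_norm power_less_one_iff abs_square_less_1)
    then have "(norm (y - x))\<^sup>2 = 0"
      using int by (intro Ints_nonzero_abs_less1) auto
    then show "y = x"
      by simp
  qed
qed simp

text \<open>\<open>LEAST\<close> over the reals says something only once a least element is
  exhibited. Here the squared norms are natural numbers, and well-ordering supplies one.\<close>

lemma lattice_minimum_le:
  assumes "integral_lattice L" "x \<in> L" "x \<noteq> 0"
  shows "lattice_minimum L \<le> (norm x)\<^sup>2"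
proof -
  \<comment> \<open>On \<open>L\<close> the floor loses nothing, as \<open>n\<close> records; it
    only moves the squared norm to type \<open>nat\<close>.\<close>
  let ?n = "\<lambda>x::'a. nat \<lfloor>(norm x)\<^sup>2\<rfloor>"
  have n: "real (?n w) = (norm w)\<^sup>2" if "w \<in> L" for w
    using integral_lattice_norm_sq_int[OF assms(1) that] by (auto elim!: Ints_cases simp: of_nat_nat)
  obtain z where z: "z \<in> L - {0}" "\<And>w. w \<in> L - {0} \<Longrightarrow> ?n z \<le> ?n w"
    using ex_has_least_nat[of "\<lambda>x. x \<in> L - {0}" x ?n] assms by auto
  have le: "(norm z)\<^sup>2 \<le> (norm w)\<^sup>2" if "w \<in> L - {0}" for w
    using z(2)[OF that] z(1) that n[of z] n[of w] by (metis DiffD1 of_nat_le_iff)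
  have "lattice_minimum L = (norm z)\<^sup>2"
    unfolding lattice_minimum_def by (rule Least_equality) (use z(1) le in blast)+
  then show ?thesis
    using le[of x] assms by simp
qed

section \<open>The glue group and the glue radius\<close>

lemma equiv_glue_rel:
  assumes "is_lattice L"
  shows "equiv (dual_lattice L) (glue_rel L)"
proof (rule equivI)
  show "refl_on (dual_lattice L) (glue_rel L)"
    using zero_in_lattice[OF assms] by (auto simp: refl_on_def glue_rel_def)
  have "y - x \<in> L" if "x - y \<in> L" for x y
    using is_lattice_diff[OF assms zero_in_lattice[OF assms] that] by simp
  then show "sym (glue_rel L)"
    by (auto simp: sym_def glue_rel_def)
  have "x - z \<in> L" if "x - y \<in> L" "y - z \<in> L" for x y z
  proof -
    have "z - y \<in> L"
      using is_lattice_diff[OF assms zero_in_lattice[OF assms] that(2)] by simp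
    from is_lattice_diff[OF assms that(1) this] show ?thesis
      by simp
  qed
  then show "trans (glue_rel L)"
    unfolding trans_def glue_rel_def by blast
qed (auto simp: glue_rel_def)

text \<open>Reducing a dual vector modulo \<open>L\<close> keeps it in the dual, because an integral
  lattice lies in its own dual. The dual vectors in the ball of radius \<open>R\<close> thus
  represent all classes, and there are finitely many of them.\<close>

lemma finite_glue_representatives:
  assumes "integral_lattice L"
  obtains F where "finite F" "F \<subseteq> dual_lattice L"
    "\<And>y. y \<in> dual_lattice L \<Longrightarrow> \<exists>z\<in>F. y - z \<in> L"
proof -
  have L: "is_lattice L"
    using assms by (simp add: integral_lattice_def)
  obtain R where R: "\<And>y. y \<in> span L \<Longrightarrow> \<exists>x\<in>L. norm (y - x) \<le> R"
    using lattice_reduction[OF L] by blast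
  show thesis
  proof (rule that)
    show "finite (dual_lattice L \<inter> cball 0 R)"
      by (rule finite_dual_lattice_cball[OF L])
    fix y assume y: "y \<in> dual_lattice L"
    then obtain x where x: "x \<in> L" "norm (y - x) \<le> R"
      using R by (auto simp: dual_lattice_def)
    then have "y - x \<in> dual_lattice L"
      using y integral_lattice_subset_dual[OF assms] by (auto intro: dual_lattice_diff)
    then show "\<exists>z\<in>dual_lattice L \<inter> cball 0 R. y - z \<in> L"
      using x by (intro bexI[of _ "y - x"]) auto
  qed auto
qed

lemma finite_glue_quotient:
  assumes "integral_lattice L"
  shows "finite (dual_lattice L // glue_rel L)"
proof -
  have eq: "equiv (dual_lattice L) (glue_rel L)"
    using assms by (intro equiv_glue_rel) (simp add: integral_lattice_def)
  obtain F where F: "finite F" "F \<subseteq> dual_lattice L"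
    "\<And>y. y \<in> dual_lattice L \<Longrightarrow> \<exists>z\<in>F. y - z \<in> L"
    using finite_glue_representatives[OF assms] by blast
  have "dual_lattice L // glue_rel L \<subseteq> (\<lambda>z. glue_rel L `` {z}) ` F"
  proof
    fix X assume "X \<in> dual_lattice L // glue_rel L"
    then obtain y where y: "X = glue_rel L `` {y}" "y \<in> dual_lattice L"
      by (rule quotientE)
    then obtain z where z: "z \<in> F" "(y, z) \<in> glue_rel L"
      using F unfolding glue_rel_def by blast
    then show "X \<in> (\<lambda>z. glue_rel L `` {z}) ` F"
      using equiv_class_eq[OF eq z(2)] y(1) by blast
  qed
  then show ?thesis
    using F(1) by (rule finite_surj[rotated])
qed

text \<open>The distance takes the same values on the whole dual as on a finite set of
  representatives. The set of values is thus finite and nonempty, and its \<open>Max\<close> is what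
  \<open>GREATEST\<close> denotes.\<close>

lemma glue_radius_max:
  assumes "integral_lattice L"
  shows "\<exists>y\<in>dual_lattice L. infdist y L = glue_radius L"
    and "\<forall>y\<in>dual_lattice L. infdist y L \<le> glue_radius L"
proof -
  have L: "is_lattice L"
    using assms by (simp add: integral_lattice_def)
  obtain F where F: "finite F" "F \<subseteq> dual_lattice L"
    "\<And>y. y \<in> dual_lattice L \<Longrightarrow> \<exists>z\<in>F. y - z \<in> L"
    using finite_glue_representatives[OF assms] by blast
  have "infdist y L \<in> (\<lambda>y. infdist y L) ` F" if y: "y \<in> dual_lattice L" for y
  proof -
    obtain z where "z \<in> F" "y - z \<in> L"
      using F(3)[OF y] by blast
    then show ?thesis
      \<comment> \<open>Subtracting the lattice vector \<open>y - z\<close> from \<open>y\<close>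
        leaves the representative \<open>z\<close>.\<close>
      using infdist_diff_lattice[OF L, of "y - z" y] by (simp add: image_iff) metis
  qed
  then have im: "(\<lambda>y. infdist y L) ` dual_lattice L = (\<lambda>y. infdist y L) ` F"
    using F(2) by blast
  let ?S = "(\<lambda>y. infdist y L) ` dual_lattice L"
  have "0 \<in> dual_lattice L"
    using integral_lattice_subset_dual[OF assms] zero_in_lattice[OF L] by blast
  then have S: "finite ?S" "?S \<noteq> {}"
    using F(1) im by auto
  have "glue_radius L = Max ?S"
    unfolding glue_radius_def using Max_in[OF S] Max_ge[OF S(1)] by (rule Greatest_equality)
  then show "\<exists>y\<in>dual_lattice L. infdist y L = glue_radius L"
    and "\<forall>y\<in>dual_lattice L. infdist y L \<le> glue_radius L"
    using Max_in[OF S] Max_ge[OF S(1)] by auto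
qed

section \<open>The covering radius\<close>

lemma infdist_le_covering_radius:
  fixes L :: "'a::euclidean_space set"
  assumes L: "is_lattice L" and y: "y \<in> span L"
  shows "infdist y L \<le> covering_radius L"
proof -
  obtain R where R: "\<And>y. y \<in> span L \<Longrightarrow> \<exists>x\<in>L. norm (y - x) \<le> R"
    using lattice_reduction[OF L] by blast
  \<comment> \<open>Every distance already occurs on this compact piece of the span, so continuity
    yields a maximizer \<open>m\<close> that is global on \<open>span L\<close> and gives
    \<open>GREATEST\<close> its value.\<close>
  let ?C = "span L \<inter> cball 0 R"
  have red: "\<exists>w\<in>?C. infdist z L = infdist w L" if z: "z \<in> span L" for z
  proof -
    obtain x where x: "x \<in> L" "norm (z - x) \<le> R"
      using R[OF z] by blast
    then have "z - x \<in> ?C"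
      using span_diff[OF z span_base[OF x(1)]] by simp
    then show ?thesis
      using infdist_diff_lattice[OF L x(1), of z] by metis
  qed
  have "compact ?C"
    by (intro closed_Int_compact closed_subspace subspace_span compact_cball)
  moreover have "?C \<noteq> {}"
    using red[OF y] by blast
  moreover have "continuous_on ?C (\<lambda>y. infdist y L)"
    by (intro continuous_intros)
  ultimately obtain m where m: "m \<in> ?C" "\<And>w. w \<in> ?C \<Longrightarrow> infdist w L \<le> infdist m L"
    using continuous_attains_sup[of ?C "\<lambda>y. infdist y L"] by metis
  have le: "infdist z L \<le> infdist m L" if "z \<in> span L" for z
    using red[OF that] m(2) by metis
  have "covering_radius L = infdist m L"
    unfolding covering_radius_def by (rule Greatest_equality) (use m(1) le in auto)
  then show ?thesis
    using le[OF y] by simp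
qed

section \<open>Orthogonal projection and the norm bound\<close>

lemma orth_proj:
  fixes V :: "'a::euclidean_space set"
  assumes "subspace V"
  shows "orth_proj V x \<in> V \<and> x - orth_proj V x \<in> V\<^sup>\<bottom>"
  unfolding orth_proj_def
proof (rule theI')
  \<comment> \<open>The description by \<open>THE\<close> requires unique existence. Existence is
    the orthogonal decomposition; for uniqueness, two candidates differ by a vector of
    \<open>V\<close> that is also orthogonal to \<open>V\<close>, hence to itself.\<close>
  obtain p q where pq: "p \<in> span V" "\<And>w. w \<in> span V \<Longrightarrow> orthogonal q w" "x = p + q"
    using orthogonal_subspace_decomp_exists[of V x] by blast
  have "p \<in> V"
    using pq(1) assms span_eq_iff by blast
  moreover have "x - p \<in> V\<^sup>\<bottom>"
    using pq(2,3) by (auto simp: orthogonal_comp_def orthogonal_commute span_base)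
  moreover have "p' = p" if "p' \<in> V" "x - p' \<in> V\<^sup>\<bottom>" for p'
  proof -
    have "(x - p) - (x - p') \<in> V\<^sup>\<bottom>"
      using \<open>x - p \<in> V\<^sup>\<bottom>\<close> that(2) by (rule subspace_diff[OF subspace_orthogonal_comp])
    moreover have "p' - p \<in> V"
      using assms that(1) \<open>p \<in> V\<close> by (rule subspace_diff)
    ultimately have "orthogonal (p' - p) (p' - p)"
      by (simp add: orthogonal_comp_def)
    then show ?thesis
      by (simp add: orthogonal_self)
  qed
  ultimately show "\<exists>!p. p \<in> V \<and> x - p \<in> V\<^sup>\<bottom>"
    by blast
qed

lemma integral_sublattice:
  assumes "integral_lattice L" "is_lattice K" "K \<subseteq> L"
  shows "integral_lattice K"
  using assms unfolding integral_lattice_def by blast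

lemma norm_orth_proj_ge:
  fixes L K :: "'a::euclidean_space set"
  defines "p \<equiv> orth_proj ((span K)\<^sup>\<bottom>)"
  assumes L: "integral_lattice L" and K: "is_lattice K" "K \<subseteq> L"
    and v: "v \<in> L" "p v \<noteq> 0"
  shows "lattice_minimum L - (glue_radius K)\<^sup>2 \<le> (norm (p v))\<^sup>2"
proof -
  have intK: "integral_lattice K"
    using integral_sublattice[OF L K] .
  define u where "u = v - p v"
  have pv: "orthogonal w (p v)" if "w \<in> span K" for w
    using orth_proj[OF subspace_orthogonal_comp, of "span K" v] that
    by (simp add: p_def orthogonal_comp_def)
  \<comment> \<open>The projection leaves \<open>u\<close> in the double orthogonal complement of
    \<open>span K\<close>, which is \<open>span K\<close> again.\<close>
  have uU: "u \<in> span K"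
    using orth_proj[OF subspace_orthogonal_comp, of "span K" v]
    by (simp add: p_def u_def orthogonal_comp_self)
  have "u \<bullet> x = v \<bullet> x" if "x \<in> K" for x
    using pv[OF span_base[OF that]]
    by (simp add: u_def orthogonal_def inner_diff_left inner_commute[of x])
  moreover have "v \<bullet> x \<in> \<int>" if "x \<in> K" for x
    using L K v(1) that by (auto simp: integral_lattice_def)
  ultimately have dual: "u \<in> dual_lattice K"
    using uU by (simp add: dual_lattice_def)
  obtain x where x: "x \<in> K" "infdist u K = dist u x"
    using infdist_attains_inf[OF closed_integral_lattice[OF intK]] zero_in_lattice[OF K(1)] by blast
  have orth: "orthogonal (u - x) (p v)"
    using span_diff[OF uU span_base[OF x(1)]] by (rule pv)
  have sum: "v - x = (u - x) + p v"
    by (simp add: u_def)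
  have pyth: "(norm (v - x))\<^sup>2 = (norm (u - x))\<^sup>2 + (norm (p v))\<^sup>2"
    unfolding sum by (rule norm_add_Pythagorean[OF orth])
  \<comment> \<open>Here the nonzero projection enters: by Pythagoras \<open>v - x\<close> is at
    least as long as \<open>p v\<close>.\<close>
  have "v - x \<noteq> 0"
    using pyth v(2) by (auto simp: add_nonneg_eq_0_iff)
  moreover have "v - x \<in> L"
    using L K(2) v(1) x(1) by (auto simp: integral_lattice_def intro: is_lattice_diff)
  ultimately have "lattice_minimum L \<le> (norm (v - x))\<^sup>2"
    by (intro lattice_minimum_le[OF L])
  \<comment> \<open>Since \<open>u\<close> lies in the dual and not merely in the span, the glue
    radius bounds its distance to \<open>K\<close>.\<close>
  moreover have "(norm (u - x))\<^sup>2 \<le> (glue_radius K)\<^sup>2"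
    using glue_radius_max(2)[OF intK] dual x(2) by (intro power_mono) (auto simp: dist_norm)
  ultimately show ?thesis
    using pyth by linarith
qed

text \<open>The first four conjuncts together express that the glue radius is a maximum over the
  finitely many classes of the glue group: the quotient is finite, the distance is constant on
  classes, and the radius is an attained upper bound.\<close>

theorem lemma13:
  fixes \<Lambda> K U V :: "'a::euclidean_space set" and \<mu> :: real and k :: nat
  assumes "integral_lattice \<Lambda>"
    and "\<mu> = lattice_minimum \<Lambda>"
    and "lattice_of_rank k K" and "K \<subseteq> \<Lambda>"
    and "U = span K" and "V = U\<^sup>\<bottom>"
  shows "finite (dual_lattice K // glue_rel K) \<and>
         (\<lambda>y. infdist y K) respects glue_rel K \<and>
         (\<exists>y\<in>dual_lattice K. infdist y K = glue_radius K) \<and>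
         (\<forall>y\<in>dual_lattice K. infdist y K \<le> glue_radius K) \<and>
         (\<forall>v\<in>\<Lambda>. orth_proj V v \<noteq> 0 \<longrightarrow>
           (norm (orth_proj V v))\<^sup>2 \<ge> \<mu> - (glue_radius K)\<^sup>2) \<and>
         glue_radius K \<le> covering_radius K"
proof -
  have K: "is_lattice K"
    using assms(3) by (auto simp: is_lattice_def)
  have intK: "integral_lattice K"
    using integral_sublattice[OF assms(1) K assms(4)] .
  have "(\<lambda>y. infdist y K) respects glue_rel K"
  proof (rule congruentI)
    fix y z assume "(y, z) \<in> glue_rel K"
    then show "infdist y K = infdist z K"
      using infdist_diff_lattice[OF K, of "y - z" y] by (simp add: glue_rel_def)
  qed
  moreover have "glue_radius K \<le> covering_radius K"
  proof -
    \<comment> \<open>A maximizer over the dual lies in the span of \<open>K\<close>, so its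
      distance competes in the maximum defining the covering radius.\<close>
    obtain y where "y \<in> dual_lattice K" "infdist y K = glue_radius K"
      using glue_radius_max(1)[OF intK] by blast
    then show ?thesis
      using infdist_le_covering_radius[OF K, of y] by (simp add: dual_lattice_def)
  qed
  moreover have "\<forall>v\<in>\<Lambda>. orth_proj V v \<noteq> 0 \<longrightarrow>
      (norm (orth_proj V v))\<^sup>2 \<ge> \<mu> - (glue_radius K)\<^sup>2"
    using norm_orth_proj_ge[OF assms(1) K assms(4)] assms(2,5,6) by simp
  ultimately show ?thesis
    using finite_glue_quotient[OF intK] glue_radius_max[OF intK] by blast
qed

end
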